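(* Let $w\in W$. (a) $\tilde\tau(w)$ is a polynomial with coefficients in $\mathbf N$ in $(v-v^{-1})$; hence it is invariant under the field automorphism $\bar{\ }$ of $\mathbf Q(v)$. (b) For any $z\in W$, $\tilde R_{z,w}$ is a polynomial with coefficients in $\mathbf N$ in $(v-v^{-1})$; hence it is invariant under the field automorphism $\bar{\ }$ of $\mathbf Q(v)$.
   Context: $W$ is a Weyl group with length function $w\mapsto|w|$, and $\mathbf N=\{0,1,2,\dots\}$. The Iwahori-Hecke algebra $\mathcal H$ of $W$ over $\mathbf Q(\mathbf q)$ ($\mathbf q$ an indeterminate) has $\mathbf Q(\mathbf q)$-basis $\{T_w:w\in W\}$ with $T_wT_{w'}=T_{ww'}$ if $|ww'|=|w|+|w'|$ and $(T_t-\mathbf q)(T_t+1)=0$ if $|t|=1$. For $w\in W$, $\tau(w,\mathbf q)\in\mathbf Z[\mathbf q]$ is the trace of the linear map $\mathcal H\to\mathcal H$, $h\mapsto T_wh$. The polynomials $R_{z,w,\mathbf q}\in\mathbf Z[\mathbf q]$ ($z,w\in W$) are defined by $$(-\mathbf q)^{|w|}T_{w^{-1}}^{-1}=\sum_{z\in W}(-1)^{|z|}R_{z,w,\mathbf q}T_z\quad\text{in }\mathcal H.$$ Let $v$ be an indeterminate and view $\mathbf Q(\mathbf q)$ as a subfield of $\mathbf Q(v)$ via $\mathbf q=v^2$. Set $\tilde\tau(w)=v^{-|w|}\tau(w,\mathbf q)\in\mathbf Q(v)$ and $\tilde R_{z,w}=v^{-|w|+|z|}R_{z,w,\mathbf q}\in\mathbf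 Q(v)$. The map $\xi\mapsto\bar\xi$ is the field automorphism of $\mathbf Q(v)$ (over $\mathbf Q$) given by $v\mapsto-v^{-1}$. *)

theory Defs
  imports "HOL-Analysis.Analysis" "HOL-Computational_Algebra.Computational_Algebra"
    "HOL-Computational_Algebra.Field_as_Ring"
begin

section \<open>Weyl groups\<close>

definition reflection :: "'a::real_inner \<Rightarrow> 'a \<Rightarrow> 'a" where
  "reflection \<alpha> x = x - (2 * (x \<bullet> \<alpha>) / (\<alpha> \<bullet> \<alpha>)) *\<^sub>R \<alpha>"

text \<open>A reduced crystallographic root system with a chosen base. The roots need not span the
  ambient space; in particular the trivial Weyl group (no roots) is allowed.\<close>

locale based_root_system =
  fixes \<Phi> \<Delta> :: "'a::euclidean_space set"
  assumes finite_roots: "finite \<Phi>"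
    and zero_not_root: "0 \<notin> \<Phi>"
    and reflection_root: "\<lbrakk>\<alpha> \<in> \<Phi>; \<beta> \<in> \<Phi>\<rbrakk> \<Longrightarrow> reflection \<alpha> \<beta> \<in> \<Phi>"
    and crystallographic: "\<lbrakk>\<alpha> \<in> \<Phi>; \<beta> \<in> \<Phi>\<rbrakk> \<Longrightarrow> 2 * (\<beta> \<bullet> \<alpha>) / (\<alpha> \<bullet> \<alpha>) \<in> \<int>"
    and reduced: "\<lbrakk>\<alpha> \<in> \<Phi>; c *\<^sub>R \<alpha> \<in> \<Phi>\<rbrakk> \<Longrightarrow> c = 1 \<or> c = -1"
    and simple_subset: "\<Delta> \<subseteq> \<Phi>"
    and simple_independent: "independent \<Delta>"
    and simple_base: "\<beta> \<in> \<Phi> \<Longrightarrow> \<exists>c :: 'a \<Rightarrow> nat.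
      \<beta> = (\<Sum>\<alpha>\<in>\<Delta>. real (c \<alpha>) *\<^sub>R \<alpha>) \<or> \<beta> = - (\<Sum>\<alpha>\<in>\<Delta>. real (c \<alpha>) *\<^sub>R \<alpha>)"

text \<open>Reflections are involutions, so closing under products already gives a group.\<close>

inductive_set weyl_group :: "'a::euclidean_space set \<Rightarrow> ('a \<Rightarrow> 'a) set"
  for \<Phi> :: "'a set" where
  id: "id \<in> weyl_group \<Phi>"
| reflect: "\<lbrakk>\<alpha> \<in> \<Phi>; w \<in> weyl_group \<Phi>\<rbrakk> \<Longrightarrow> reflection \<alpha> \<circ> w \<in> weyl_group \<Phi>"

definition weyl_length :: "'a::euclidean_space set \<Rightarrow> ('a \<Rightarrow> 'a) \<Rightarrow> nat" where
  "weyl_length \<Delta> w = (LEAST n. \<exists>\<alpha>s. length \<alpha>s = n \<and> set \<alpha>s \<subseteq> \<Delta> \<and>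
     w = foldr (\<circ>) (map reflection \<alpha>s) id)"

section \<open>Rational functions in one variable\<close>

text \<open>The type \<open>rat poly fract\<close> serves both as \<open>Q(q)\<close> and as \<open>Q(v)\<close>; \<open>indet\<close> is the
  indeterminate of either field.\<close>

definition indet :: "rat poly fract" where
  "indet = to_fract [:0, 1:]"

text \<open>Substitution of \<open>x\<close> for the indeterminate; the conventional \<open>/ 0\<close> never arises
  when \<open>x\<close> is transcendental over the rationals.\<close>

definition ratfun_subst :: "'k::field_char_0 \<Rightarrow> rat poly fract \<Rightarrow> 'k" where
  "ratfun_subst x f =
     poly (map_poly of_rat (fst (quot_of_fract f))) x /
     poly (map_poly of_rat (snd (quot_of_fract f))) x"

text \<open>The embedding of \<open>Q(q)\<close> into \<open>Q(v)\<close> given by \<open>q = v\<^sup>2\<close>.\<close>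

definition q_embed :: "rat poly fract \<Rightarrow> rat poly fract" where
  "q_embed = ratfun_subst (indet ^ 2)"

definition bar :: "rat poly fract \<Rightarrow> rat poly fract" where
  "bar = ratfun_subst (- inverse indet)"

abbreviation eval_at :: "'k::field_char_0 \<Rightarrow> rat poly \<Rightarrow> 'k" where
  "eval_at x p \<equiv> poly (map_poly of_rat p) x"

lemma eval_at_add: "eval_at x (p + q) = eval_at x p + eval_at x q"
proof -
  have "map_poly of_rat (p + q) = (map_poly of_rat p + map_poly of_rat q :: 'a poly)"
    by (rule poly_eqI) (simp add: coeff_map_poly of_rat_add)
  then show ?thesis by simp
qed

lemma eval_at_smult: "eval_at x (smult c p) = of_rat c * eval_at x p"
proof -
  have "map_poly of_rat (smult c p) = (smult (of_rat c) (map_poly of_rat p) :: 'a poly)"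
    by (rule poly_eqI) (simp add: coeff_map_poly of_rat_mult)
  then show ?thesis by simp
qed

lemma eval_at_pCons: "eval_at x (pCons c p) = of_rat c + x * eval_at x p"
  by (simp add: map_poly_pCons)

lemma eval_at_mult: "eval_at x (p * q) = eval_at x p * eval_at x q"
  by (induction p)
    (simp_all add: eval_at_add eval_at_smult eval_at_pCons algebra_simps)

definition transc :: "'k::field_char_0 \<Rightarrow> bool" where
  "transc x \<longleftrightarrow> (\<forall>p. eval_at x p = 0 \<longrightarrow> p = 0)"

lemma ratfun_subst_Fract:
  assumes "transc x" "b \<noteq> 0"
  shows "ratfun_subst x (Fract a b) = eval_at x a / eval_at x b"
proof -
  obtain c d where cd: "quot_of_fract (Fract a b) = (c, d)" by fastforce
  have d: "d \<noteq> 0" using snd_quot_of_fract_nonzero[of "Fract a b"] cd by simp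
  have "Fract c d = Fract a b" using Fract_quot_of_fract[of "Fract a b"] cd by simp
  then have "c * b = a * d" using d assms by (simp add: eq_fract)
  then have "eval_at x c * eval_at x b = eval_at x a * eval_at x d"
    by (metis eval_at_mult)
  moreover have "eval_at x b \<noteq> 0" "eval_at x d \<noteq> 0"
    using assms d by (auto simp: transc_def)
  ultimately show ?thesis by (simp add: ratfun_subst_def cd field_simps)
qed

lemma ratfun_subst_hom:
  assumes "transc x"
  shows "ratfun_subst x (f + g) = ratfun_subst x f + ratfun_subst x g"
    and "ratfun_subst x (f * g) = ratfun_subst x f * ratfun_subst x g"
proof -
  obtain a b where f: "f = Fract a b" "b \<noteq> 0" by (cases f) auto
  obtain c d where g: "g = Fract c d" "d \<noteq> 0" by (cases g) auto
  have nz: "eval_at x b \<noteq> 0" "eval_at x d \<noteq> 0"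
    using assms f g by (auto simp: transc_def)
  show "ratfun_subst x (f + g) = ratfun_subst x f + ratfun_subst x g"
    using f g assms nz
    by (simp add: ratfun_subst_Fract eval_at_add eval_at_mult field_simps)
  show "ratfun_subst x (f * g) = ratfun_subst x f * ratfun_subst x g"
    using f g assms nz
    by (simp add: ratfun_subst_Fract eval_at_mult)
qed

lemma ratfun_subst_of_rat: "transc x \<Longrightarrow> ratfun_subst x (to_fract [:c:]) = of_rat c"
  by (simp add: to_fract_def ratfun_subst_Fract map_poly_pCons)

lemma ratfun_subst_indet: "transc x \<Longrightarrow> ratfun_subst x indet = x"
  by (simp add: indet_def to_fract_def ratfun_subst_Fract map_poly_pCons)

lemma of_rat_to_fract: "(of_rat c :: rat poly fract) = to_fract [:c:]"
proof -
  have of_nat: "(of_nat n :: rat poly fract) = to_fract [:of_nat n:]" for n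
    by (induction n) (simp_all flip: to_fract_1 to_fract_add add: one_pCons)
  have of_int: "(of_int i :: rat poly fract) = to_fract [:of_int i:]" for i
    by (cases i rule: int_diff_cases) (simp add: of_nat flip: to_fract_diff)
  obtain i j where c: "c = Rat.Fract i j" "j > 0" by (cases c)
  then have c': "c * of_int j = of_int i"
    by (simp add: Fract_of_int_quotient)
  have "(of_rat c :: rat poly fract) * of_int j = of_int i"
    by (metis c' of_rat_mult of_rat_of_int_eq)
  moreover have "to_fract [:c:] * of_int j = (of_int i :: rat poly fract)"
    using c' by (simp add: of_int mult.commute flip: to_fract_mult)
  moreover have "(of_int j :: rat poly fract) \<noteq> 0"
    using c by (simp add: of_int)
  ultimately show ?thesis by (metis mult_right_cancel)
qed

lemma eval_at_to_fract: "eval_at (to_fract r) p = to_fract (pcompose p r)"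
proof (induction p)
  case (pCons a p)
  show ?case
    unfolding eval_at_pCons pcompose_pCons pCons.IH of_rat_to_fract[of a] by simp
qed simp

lemma transc_to_fract: "degree (r :: rat poly) > 0 \<Longrightarrow> transc (to_fract r)"
  unfolding transc_def by (auto simp: eval_at_to_fract dest: pcompose_eq_0)

lemma transc_inverse:
  assumes "transc x"
  shows "transc (inverse x)"
  unfolding transc_def
proof (intro allI impI)
  fix p assume p: "eval_at (inverse x) p = 0"
  have "x \<noteq> 0" using assms[unfolded transc_def, rule_format, of "[:0, 1:]"]
    by (auto simp: map_poly_pCons)
  have "map_poly of_rat (reflect_poly p) = (reflect_poly (map_poly of_rat p) :: 'a poly)"
    by (rule poly_eqI)
      (simp add: coeff_map_poly coeff_reflect_poly degree_map_poly)
  then have "eval_at x (reflect_poly p) = 0"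
    using p \<open>x \<noteq> 0\<close> by (simp add: poly_reflect_poly_nz)
  then show "p = 0" using assms by (auto simp: transc_def)
qed

lemma transc_q: "transc (indet ^ 2)"
proof -
  have "indet ^ 2 = to_fract [:0, 0, 1:]"
    by (simp add: indet_def power2_eq_square flip: to_fract_mult)
  then show ?thesis using transc_to_fract[of "[:0, 0, 1:]"] by simp
qed

lemma transc_bar: "transc (- inverse indet)"
proof -
  have "- inverse indet = inverse (to_fract [:0, -1:])"
    by (simp add: indet_def flip: to_fract_uminus inverse_minus_eq)
  then show ?thesis using transc_inverse[OF transc_to_fract[of "[:0, -1:]"]] by simp
qed

lemmas q_embed_hom = ratfun_subst_hom[OF transc_q, folded q_embed_def]
  and q_embed_of_rat = ratfun_subst_of_rat[OF transc_q, folded q_embed_def]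
  and q_embed_indet = ratfun_subst_indet[OF transc_q, folded q_embed_def]
  and bar_hom = ratfun_subst_hom[OF transc_bar, folded bar_def]
  and bar_of_rat = ratfun_subst_of_rat[OF transc_bar, folded bar_def]
  and bar_indet = ratfun_subst_indet[OF transc_bar, folded bar_def]

lemma bar_bar: "bar (bar f) = f"
proof -
  have bar_eval: "bar (eval_at x p) = eval_at (bar x) p" for x p
  proof (induction p)
    case (pCons a p)
    have "bar (of_rat a) = of_rat a" unfolding of_rat_to_fract[of a] bar_of_rat ..
    then show ?case
      unfolding eval_at_pCons bar_hom pCons.IH by simp
  qed (use bar_of_rat[of 0] in simp)
  have one: "bar 1 = 1" using bar_of_rat[of 1] by (simp flip: one_pCons)
  have inv: "bar (inverse g) = inverse (bar g)" for g
    by (metis bar_hom(2) bar_of_rat[of 0, simplified] inverse_unique inverse_zero one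
        right_inverse)
  have neg: "bar (- g) = - bar g" for g
    by (metis add.right_inverse bar_hom(1) bar_of_rat[of 0, simplified]
        add_eq_0_iff)
  have v: "bar (bar indet) = indet"
    by (simp add: bar_indet neg inv)
  obtain a b where f: "f = Fract a b" "b \<noteq> 0" by (cases f) auto
  have "to_fract p = eval_at indet p" for p
    by (simp add: indet_def eval_at_to_fract)
  then have f': "f = eval_at indet a * inverse (eval_at indet b)"
    using f by (simp add: Fract_conv_to_fract divide_inverse)
  show ?thesis
    by (simp add: f' bar_hom inv bar_eval v)
qed

section \<open>The Iwahori-Hecke algebra\<close>

definition ring_inverse :: "'h::ring_1 \<Rightarrow> 'h" where
  "ring_inverse x = (THE y. x * y = 1 \<and> y * x = 1)"

context vector_space
begin

definition trace_basis :: "'b set \<Rightarrow> ('b \<Rightarrow> 'b) \<Rightarrow> 'a" where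
  "trace_basis B f = (\<Sum>b\<in>B. representation B (f b) b)"

end

locale iwahori_hecke_algebra =
  based_root_system \<Phi> \<Delta> + vector_space scale
  for \<Phi> \<Delta> :: "'a::euclidean_space set"
    and scale :: "rat poly fract \<Rightarrow> 'h::ring_1 \<Rightarrow> 'h" +
  fixes T :: "('a \<Rightarrow> 'a) \<Rightarrow> 'h"
  assumes scale_mult_left: "scale c x * y = scale c (x * y)"
    and scale_mult_right: "x * scale c y = scale c (x * y)"
    and T_inj: "inj_on T (weyl_group \<Phi>)"
    and T_independent: "\<not> dependent (T ` weyl_group \<Phi>)"
    and T_span: "span (T ` weyl_group \<Phi>) = UNIV"
    and T_mult: "\<lbrakk>w \<in> weyl_group \<Phi>; w' \<in> weyl_group \<Phi>;
        weyl_length \<Delta> (w \<circ> w') = weyl_length \<Delta> w + weyl_length \<Delta> w'\<rbrakk>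
      \<Longrightarrow> T w * T w' = T (w \<circ> w')"
    and T_quadratic: "\<lbrakk>t \<in> weyl_group \<Phi>; weyl_length \<Delta> t = 1\<rbrakk>
      \<Longrightarrow> (T t - scale indet 1) * (T t + 1) = 0"
begin

abbreviation W :: "('a \<Rightarrow> 'a) set" where
  "W \<equiv> weyl_group \<Phi>"

abbreviation len :: "('a \<Rightarrow> 'a) \<Rightarrow> nat" where
  "len \<equiv> weyl_length \<Delta>"

definition tau :: "('a \<Rightarrow> 'a) \<Rightarrow> rat poly fract" where
  "tau w = trace_basis (T ` W) (\<lambda>h. T w * h)"

text \<open>Obtained by solving the defining equation \<open>R_defining_equation\<close> below for \<open>R z w\<close>.\<close>

definition R :: "('a \<Rightarrow> 'a) \<Rightarrow> ('a \<Rightarrow> 'a) \<Rightarrow> rat poly fract" where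
  "R z w = (-1) ^ len z *
     representation (T ` W) (scale ((- indet) ^ len w) (ring_inverse (T (inv w)))) (T z)"

definition tau_tilde :: "('a \<Rightarrow> 'a) \<Rightarrow> rat poly fract" where
  "tau_tilde w = indet powi (- int (len w)) * q_embed (tau w)"

definition R_tilde :: "('a \<Rightarrow> 'a) \<Rightarrow> ('a \<Rightarrow> 'a) \<Rightarrow> rat poly fract" where
  "R_tilde z w = indet powi (- int (len w) + int (len z)) * q_embed (R z w)"

lemma weyl_group_root: "w \<in> W \<Longrightarrow> \<alpha> \<in> \<Phi> \<Longrightarrow> w \<alpha> \<in> \<Phi>"
  by (induction rule: weyl_group.induct) (auto intro: reflection_root)

lemma weyl_group_linear: "w \<in> W \<Longrightarrow> linear w"
proof (induction rule: weyl_group.induct)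
  case id
  show ?case by (rule linearI) simp_all
next
  case (reflect \<alpha> w)
  have "linear (reflection \<alpha>)"
    by (rule linearI)
      (simp_all add: reflection_def inner_add_left algebra_simps add_divide_distrib)
  then show ?case using linear_compose reflect by blast
qed

lemma weyl_group_orthogonal:
  "w \<in> W \<Longrightarrow> (\<And>\<alpha>. \<alpha> \<in> \<Phi> \<Longrightarrow> x \<bullet> \<alpha> = 0) \<Longrightarrow> w x = x"
  by (induction rule: weyl_group.induct) (auto simp: reflection_def)

lemma finite_weyl_group: "finite W"
proof -
  have "inj_on (\<lambda>w. restrict w \<Phi>) W"
  proof (rule inj_onI)
    fix u w assume uw: "u \<in> W" "w \<in> W" "restrict u \<Phi> = restrict w \<Phi>"
    have lin: "linear u" "linear w" using uw weyl_group_linear by auto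
    have eq: "u \<alpha> = w \<alpha>" if "\<alpha> \<in> \<Phi>" for \<alpha>
      using uw(3) that by (metis restrict_apply')
    show "u = w"
    proof
      fix x
      obtain y z where yz: "y \<in> real_vector.span \<Phi>" "\<And>a. a \<in> real_vector.span \<Phi> \<Longrightarrow> orthogonal z a" "x = y + z"
        using orthogonal_subspace_decomp_exists[of \<Phi> x] by metis
      have "z \<bullet> \<alpha> = 0" if "\<alpha> \<in> \<Phi>" for \<alpha>
        using yz(2) real_vector.span_base[OF that] by (simp add: orthogonal_def)
      then have "u z = z" "w z = z" using uw weyl_group_orthogonal by blast+
      moreover have "u y = w y"
        using linear_eq_on_span[OF lin eq] yz(1) by blast
      ultimately show "u x = w x" by (simp add: yz(3) linear_add[OF lin(1)] linear_add[OF lin(2)])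
    qed
  qed
  moreover have "(\<lambda>w. restrict w \<Phi>) ` W \<subseteq> \<Phi> \<rightarrow>\<^sub>E \<Phi>"
    using weyl_group_root by auto
  ultimately show ?thesis
    by (meson finite_PiE finite_imageD finite_roots finite_subset)
qed

lemma R_defining_equation:
  "scale ((- indet) ^ len w) (ring_inverse (T (inv w))) =
     (\<Sum>z\<in>W. scale ((-1) ^ len z * R z w) (T z))"
proof -
  let ?x = "scale ((- indet) ^ len w) (ring_inverse (T (inv w)))"
  have "?x = (\<Sum>b\<in>T ` W. scale (representation (T ` W) ?x b) b)"
    using sum_representation_eq[OF T_independent, of ?x "T ` W"] finite_weyl_group T_span by simp
  also have "\<dots> = (\<Sum>z\<in>W. scale (representation (T ` W) ?x (T z)) (T z))"
    by (simp add: sum.reindex[OF T_inj])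
  also have "\<dots> = (\<Sum>z\<in>W. scale ((-1) ^ len z * R z w) (T z))"
    unfolding R_def by (simp flip: mult.assoc power_add mult_2 power_mult_distrib)
  finally show ?thesis .
qed

end

section \<open>Polynomials in \<open>v - v\<^sup>-\<^sup>1\<close> with natural coefficients\<close>

definition nat_poly_in :: "rat poly fract \<Rightarrow> rat poly fract \<Rightarrow> bool" where
  "nat_poly_in x f \<longleftrightarrow> (\<exists>p :: nat poly. f = poly (map_poly of_nat p) x)"

end

theory Submission
  imports Defs
begin

text \<open>
  Rescale the standard basis to \<open>v\<^sup>-\<^sup>|\<^sup>y\<^sup>| T\<^sub>y\<close>. For a simple reflection \<open>s\<close>, left multiplication by
  \<open>v\<^sup>-\<^sup>1 T\<^sub>s\<close> sends the rescaled basis element at \<open>y\<close> to the one at \<open>sy\<close> if \<open>|sy| > |y|\<close>; otherwise the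
  quadratic relation adds \<open>v - v\<^sup>-\<^sup>1\<close> times the element at \<open>y\<close>. So all matrix entries lie in the
  semiring of polynomials in \<open>v - v\<^sup>-\<^sup>1\<close> with natural coefficients. Along a reduced word, \<open>v\<^sup>-\<^sup>|\<^sup>w\<^sup>| T\<^sub>w\<close>
  acts as a product of such operators, and the rescaled \<open>\<tau>\<close> of \<open>w\<close> is the trace of that product
  (\<open>nat_poly_in_structure_coeff\<close>, \<open>tau_tilde_eq_sum\<close>).

  For \<open>R\<close>, the inverse of \<open>T\<^sub>s\<close> is \<open>q\<^sup>-\<^sup>1 (T\<^sub>s - (q - 1))\<close>, so \<open>(-q)\<^sup>|\<^sup>w\<^sup>|\<close> times the inverse of
  \<open>T\<close> at \<open>w\<^sup>-\<^sup>1\<close> is the product of the elements \<open>(q - 1) - T\<^sub>s\<close> along a reduced word of \<open>w\<close>.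
  Rescaled by \<open>v\<^sup>-\<^sup>1\<close> and written in the signed basis \<open>(-1)\<^sup>|\<^sup>z\<^sup>| v\<^sup>-\<^sup>|\<^sup>z\<^sup>| T\<^sub>z\<close>, each factor again has its
  entries among \<open>0\<close>, \<open>1\<close> and \<open>v - v\<^sup>-\<^sup>1\<close>; the extra term now occurs when \<open>sz\<close> is longer
  (\<open>nat_poly_in_opposite_coeff\<close>).

  From the theory of Weyl groups this uses only two facts: simple reflections generate the group
  (\<open>weyl_group_reflection_word\<close>), and multiplication by one changes the length by exactly one
  (\<open>weyl_length_simple_comp\<close>). The latter is a parity statement: a product of root signs changes
  sign under each simple reflection. Invariance under \<open>bar\<close> follows since \<open>v - v\<^sup>-\<^sup>1\<close> is fixed.
\<close>

section \<open>Lengths in the Weyl group of a based root system\<close>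

lemma linear_reflection: "linear (reflection \<alpha>)"
  by (rule linearI)
    (simp_all add: reflection_def inner_add_left algebra_simps add_divide_distrib)

lemma reflection_self: "\<alpha> \<noteq> 0 \<Longrightarrow> reflection \<alpha> \<alpha> = - \<alpha>"
  by (simp add: reflection_def scaleR_2)

lemma reflection_involutive:
  assumes "\<alpha> \<noteq> 0"
  shows "reflection \<alpha> (reflection \<alpha> x) = x"
proof -
  define c where "c = 2 * (x \<bullet> \<alpha>) / (\<alpha> \<bullet> \<alpha>)"
  have c: "reflection \<alpha> x = x - c *\<^sub>R \<alpha>"
    by (simp add: c_def reflection_def)
  have "reflection \<alpha> (x - c *\<^sub>R \<alpha>) = reflection \<alpha> x - c *\<^sub>R reflection \<alpha> \<alpha>"
    by (simp add: linear_diff[OF linear_reflection] linear_scale[OF linear_reflection])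
  also have "\<dots> = x"
    by (simp add: c reflection_self[OF assms])
  finally show ?thesis by (simp only: c)
qed

lemma reflection_uminus: "reflection (- \<alpha>) = reflection \<alpha>"
  by (auto simp: reflection_def)

lemma inner_reflection: "reflection \<alpha> x \<bullet> y = x \<bullet> reflection \<alpha> y"
  by (simp add: reflection_def inner_diff_left inner_diff_right inner_commute)

lemma reflection_conjugate:
  assumes "\<alpha> \<noteq> 0"
  shows "reflection \<alpha> \<circ> reflection \<beta> \<circ> reflection \<alpha> = reflection (reflection \<alpha> \<beta>)"
proof
  fix x
  let ?s = "reflection \<alpha>"
  have "?s \<beta> \<bullet> ?s \<beta> = \<beta> \<bullet> \<beta>"
    by (simp add: inner_reflection reflection_involutive[OF assms])
  then show "(?s \<circ> reflection \<beta> \<circ> ?s) x = reflection (?s \<beta>) x"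
    by (simp add: reflection_def[of \<beta>] reflection_def[of "?s \<beta>"]
        linear_diff[OF linear_reflection] linear_scale[OF linear_reflection]
        reflection_involutive[OF assms] inner_reflection)
qed

definition reflection_word :: "'a::euclidean_space list \<Rightarrow> 'a \<Rightarrow> 'a" where
  "reflection_word \<alpha>s = foldr (\<circ>) (map reflection \<alpha>s) id"

lemma reflection_word_Nil [simp]: "reflection_word [] = id"
  and reflection_word_Cons [simp]:
    "reflection_word (\<alpha> # \<alpha>s) = reflection \<alpha> \<circ> reflection_word \<alpha>s"
  by (simp_all add: reflection_word_def)

lemma reflection_word_append [simp]:
  "reflection_word (\<alpha>s @ \<beta>s) = reflection_word \<alpha>s \<circ> reflection_word \<beta>s"
  by (induction \<alpha>s) (simp_all add: fun_eq_iff)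

lemma reflection_word_rev:
  assumes "0 \<notin> set \<alpha>s"
  shows "reflection_word (rev \<alpha>s) (reflection_word \<alpha>s x) = x"
  using assms by (induction \<alpha>s) (simp_all add: reflection_involutive)

context based_root_system
begin

lemma root_nonzero: "\<alpha> \<in> \<Phi> \<Longrightarrow> \<alpha> \<noteq> 0"
  using zero_not_root by auto

lemma root_uminus: "\<alpha> \<in> \<Phi> \<Longrightarrow> - \<alpha> \<in> \<Phi>"
  using reflection_root[of \<alpha> \<alpha>] reflection_self[of \<alpha>] root_nonzero by simp

lemma simple_root: "\<alpha> \<in> \<Delta> \<Longrightarrow> \<alpha> \<in> \<Phi>"
  using simple_subset by auto

lemma finite_simple: "finite \<Delta>"
  using finite_subset[OF simple_subset finite_roots] .

text \<open>As a linear functional on the whole space, the coordinate needs no span side conditions.\<close>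

definition coordinate :: "'a \<Rightarrow> 'a \<Rightarrow> real" where
  "coordinate \<gamma> = real_vector.construct \<Delta> (\<lambda>\<delta>. if \<delta> = \<gamma> then 1 else 0)"

lemma linear_coordinate: "linear (coordinate \<gamma>)"
  unfolding coordinate_def by (rule linear_construct[OF simple_independent])

lemma coordinate_simple: "\<delta> \<in> \<Delta> \<Longrightarrow> coordinate \<gamma> \<delta> = (if \<delta> = \<gamma> then 1 else 0)"
  unfolding coordinate_def by (simp add: construct_basis[OF simple_independent])

lemma coordinate_sum:
  assumes "\<gamma> \<in> \<Delta>"
  shows "coordinate \<gamma> (\<Sum>\<alpha>\<in>\<Delta>. c \<alpha> *\<^sub>R \<alpha>) = c \<gamma>"
proof -
  have "coordinate \<gamma> (\<Sum>\<alpha>\<in>\<Delta>. c \<alpha> *\<^sub>R \<alpha>) = (\<Sum>\<alpha>\<in>\<Delta>. if \<alpha> = \<gamma> then c \<alpha> else 0)"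
    by (auto simp: linear_sum[OF linear_coordinate] linear_scale[OF linear_coordinate]
        coordinate_simple intro!: sum.cong)
  then show ?thesis using assms finite_simple by simp
qed

lemma root_eq_sum_coordinates:
  assumes "\<beta> \<in> \<Phi>"
  shows "\<beta> = (\<Sum>\<gamma>\<in>\<Delta>. coordinate \<gamma> \<beta> *\<^sub>R \<gamma>)"
proof -
  obtain c :: "'a \<Rightarrow> real" where c: "\<beta> = (\<Sum>\<alpha>\<in>\<Delta>. c \<alpha> *\<^sub>R \<alpha>)"
  proof -
    obtain c :: "'a \<Rightarrow> nat" where
      "\<beta> = (\<Sum>\<alpha>\<in>\<Delta>. real (c \<alpha>) *\<^sub>R \<alpha>) \<or> \<beta> = - (\<Sum>\<alpha>\<in>\<Delta>. real (c \<alpha>) *\<^sub>R \<alpha>)"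
      using simple_base[OF assms] by blast
    then show ?thesis
      using that[of "\<lambda>\<alpha>. real (c \<alpha>)"] that[of "\<lambda>\<alpha>. - real (c \<alpha>)"]
      by (auto simp: sum_negf)
  qed
  have "(\<Sum>\<gamma>\<in>\<Delta>. coordinate \<gamma> \<beta> *\<^sub>R \<gamma>) = (\<Sum>\<gamma>\<in>\<Delta>. c \<gamma> *\<^sub>R \<gamma>)"
    using c by (intro sum.cong) (simp_all add: coordinate_sum)
  with c show ?thesis by simp
qed

definition positive :: "'a \<Rightarrow> bool" where
  "positive \<beta> \<longleftrightarrow> (\<forall>\<gamma>\<in>\<Delta>. coordinate \<gamma> \<beta> \<ge> 0)"

text \<open>The coordinates of a root all have the same sign, so any nonzero one decides positivity.\<close>

lemma root_positive_iff:
  assumes "\<beta> \<in> \<Phi>" "\<gamma> \<in> \<Delta>" "coordinate \<gamma> \<beta> \<noteq> 0"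
  shows "positive \<beta> \<longleftrightarrow> coordinate \<gamma> \<beta> > 0"
proof -
  obtain c :: "'a \<Rightarrow> nat" where
    "\<beta> = (\<Sum>\<alpha>\<in>\<Delta>. real (c \<alpha>) *\<^sub>R \<alpha>) \<or> \<beta> = - (\<Sum>\<alpha>\<in>\<Delta>. real (c \<alpha>) *\<^sub>R \<alpha>)"
    using simple_base[OF assms(1)] by blast
  then have "(\<forall>\<delta>\<in>\<Delta>. coordinate \<delta> \<beta> = real (c \<delta>)) \<or> (\<forall>\<delta>\<in>\<Delta>. coordinate \<delta> \<beta> = - real (c \<delta>))"
    by (auto simp: coordinate_sum linear_neg[OF linear_coordinate])
  then show ?thesis
    using assms unfolding positive_def by force
qed

lemma root_has_coordinate:
  assumes "\<beta> \<in> \<Phi>"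
  obtains \<gamma> where "\<gamma> \<in> \<Delta>" "coordinate \<gamma> \<beta> \<noteq> 0"
proof (rule ccontr)
  assume "\<not> thesis"
  then have "(\<Sum>\<gamma>\<in>\<Delta>. coordinate \<gamma> \<beta> *\<^sub>R \<gamma>) = 0"
    using that by (intro sum.neutral) auto
  then show False using root_eq_sum_coordinates[OF assms] root_nonzero[OF assms] by simp
qed

lemma positive_uminus:
  assumes "\<beta> \<in> \<Phi>"
  shows "positive (- \<beta>) \<longleftrightarrow> \<not> positive \<beta>"
proof -
  obtain \<gamma> where "\<gamma> \<in> \<Delta>" "coordinate \<gamma> \<beta> \<noteq> 0" using root_has_coordinate[OF assms] .
  then show ?thesis
    using root_positive_iff[of \<beta> \<gamma>] root_positive_iff[of "- \<beta>" \<gamma>] assms root_uminus[OF assms]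
    by (auto simp: linear_neg[OF linear_coordinate])
qed

lemma positive_simple: "\<alpha> \<in> \<Delta> \<Longrightarrow> positive \<alpha>"
  by (simp add: positive_def coordinate_simple)

text \<open>A root that is not a multiple of \<open>\<alpha>\<close> has a nonzero coordinate at another simple root.
  The reflection leaves that coordinate alone, and the coordinate decides the sign.\<close>

lemma positive_simple_reflection:
  assumes "\<alpha> \<in> \<Delta>" "\<beta> \<in> \<Phi>" "\<beta> \<noteq> \<alpha>" "\<beta> \<noteq> - \<alpha>"
  shows "positive (reflection \<alpha> \<beta>) \<longleftrightarrow> positive \<beta>"
proof -
  obtain \<gamma> where \<gamma>: "\<gamma> \<in> \<Delta>" "\<gamma> \<noteq> \<alpha>" "coordinate \<gamma> \<beta> \<noteq> 0"
  proof (rule ccontr)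
    assume "\<not> thesis"
    with that have "(\<Sum>\<gamma>\<in>\<Delta>. coordinate \<gamma> \<beta> *\<^sub>R \<gamma>) =
        (\<Sum>\<gamma>\<in>\<Delta>. if \<gamma> = \<alpha> then coordinate \<alpha> \<beta> *\<^sub>R \<alpha> else 0)"
      by (intro sum.cong) auto
    then have "\<beta> = coordinate \<alpha> \<beta> *\<^sub>R \<alpha>"
      using root_eq_sum_coordinates[OF assms(2)] assms(1) finite_simple by simp
    moreover from this have "coordinate \<alpha> \<beta> = 1 \<or> coordinate \<alpha> \<beta> = -1"
      using reduced[OF simple_root[OF assms(1)]] assms(2) by metis
    ultimately show False using assms(3,4) by (metis scaleR_minus1_left scaleR_one)
  qed
  have "coordinate \<gamma> (reflection \<alpha> \<beta>) = coordinate \<gamma> \<beta>"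
    using \<gamma> assms(1)
    by (simp add: reflection_def linear_diff[OF linear_coordinate]
        linear_scale[OF linear_coordinate] coordinate_simple)
  moreover have "reflection \<alpha> \<beta> \<in> \<Phi>"
    using reflection_root[OF simple_root] assms by blast
  ultimately show ?thesis
    using root_positive_iff[of _ \<gamma>] \<gamma> assms(2) by metis
qed

text \<open>Induction on the height: since \<open>\<beta> \<bullet> \<beta> > 0\<close>, some simple root has a positive inner
  product with \<open>\<beta>\<close>, and reflecting in it lowers the height while conjugating the reflection.\<close>

lemma positive_reflection_word:
  assumes "\<beta> \<in> \<Phi>" "positive \<beta>"
  shows "\<exists>\<alpha>s. set \<alpha>s \<subseteq> \<Delta> \<and> reflection \<beta> = reflection_word \<alpha>s"
proof -
  define height where "height \<beta> = (\<Sum>\<gamma>\<in>\<Delta>. coordinate \<gamma> \<beta>)" for \<beta>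
  define below where "below \<beta> = {\<gamma> \<in> \<Phi>. positive \<gamma> \<and> height \<gamma> < height \<beta>}" for \<beta>
  show ?thesis
    using assms
  proof (induction "card (below \<beta>)" arbitrary: \<beta> rule: less_induct)
    case less
    show ?case
    proof (cases "\<beta> \<in> \<Delta>")
      case True
      then show ?thesis by (intro exI[of _ "[\<beta>]"]) simp
    next
      case False
      obtain \<alpha> where \<alpha>: "\<alpha> \<in> \<Delta>" "\<beta> \<bullet> \<alpha> > 0"
      proof (rule ccontr)
        assume "\<not> thesis"
        with that have "\<beta> \<bullet> \<alpha> \<le> 0" if "\<alpha> \<in> \<Delta>" for \<alpha>
          using that not_le by blast
        then have "\<beta> \<bullet> (\<Sum>\<gamma>\<in>\<Delta>. coordinate \<gamma> \<beta> *\<^sub>R \<gamma>) \<le> 0"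
          using less.prems(2)
          by (auto simp: inner_sum_right positive_def mult_nonneg_nonpos intro!: sum_nonpos)
        then show False
          using root_eq_sum_coordinates[OF less.prems(1)] root_nonzero[OF less.prems(1)]
          by (metis inner_gt_zero_iff not_le)
      qed
      let ?\<beta> = "reflection \<alpha> \<beta>"
      have "\<alpha> \<noteq> 0" using \<alpha> root_nonzero simple_root by blast
      have "\<beta> \<noteq> - \<alpha>"
        using less.prems positive_simple[OF \<alpha>(1)] positive_uminus[OF simple_root[OF \<alpha>(1)]] by auto
      then have "positive ?\<beta>"
        using positive_simple_reflection[OF \<alpha>(1) less.prems(1)] less.prems(2) False \<alpha>(1) by auto
      moreover have "?\<beta> \<in> \<Phi>"
        using reflection_root simple_root \<alpha> less.prems by blast
      moreover have "height ?\<beta> < height \<beta>"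
      proof -
        have "height \<alpha> = 1"
          unfolding height_def using \<alpha>(1) finite_simple
          by (subst sum.cong[OF refl, of _ _ "\<lambda>\<gamma>. if \<gamma> = \<alpha> then 1 else 0"])
            (auto simp: coordinate_simple)
        moreover have "height ?\<beta> = height \<beta> - (2 * (\<beta> \<bullet> \<alpha>) / (\<alpha> \<bullet> \<alpha>)) * height \<alpha>"
          by (simp add: height_def reflection_def linear_diff[OF linear_coordinate]
              linear_scale[OF linear_coordinate] sum_subtractf sum_distrib_left)
        ultimately show ?thesis using \<alpha> \<open>\<alpha> \<noteq> 0\<close> by simp
      qed
      ultimately have "below ?\<beta> \<subset> below \<beta>"
        unfolding below_def using less.prems by fastforce
      then have "card (below ?\<beta>) < card (below \<beta>)"
        using finite_roots by (intro psubset_card_mono) (simp_all add: below_def)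
      then obtain \<alpha>s where \<alpha>s: "set \<alpha>s \<subseteq> \<Delta>" "reflection ?\<beta> = reflection_word \<alpha>s"
        using less.hyps \<open>?\<beta> \<in> \<Phi>\<close> \<open>positive ?\<beta>\<close> by blast
      have "reflection \<beta> = reflection \<alpha> \<circ> reflection ?\<beta> \<circ> reflection \<alpha>"
        by (simp add: reflection_conjugate[OF \<open>\<alpha> \<noteq> 0\<close>] reflection_involutive[OF \<open>\<alpha> \<noteq> 0\<close>])
      also have "\<dots> = reflection_word ([\<alpha>] @ \<alpha>s @ [\<alpha>])"
        by (simp add: \<alpha>s(2) o_assoc)
      finally have "reflection \<beta> = reflection_word ([\<alpha>] @ \<alpha>s @ [\<alpha>])" .
      moreover have "set ([\<alpha>] @ \<alpha>s @ [\<alpha>]) \<subseteq> \<Delta>" using \<alpha>(1) \<alpha>s(1) by simp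
      ultimately show ?thesis by blast
    qed
  qed
qed

text \<open>Reflections in opposite roots agree, so positive roots suffice.\<close>

lemma weyl_group_reflection_word:
  assumes "w \<in> weyl_group \<Phi>"
  shows "\<exists>\<alpha>s. set \<alpha>s \<subseteq> \<Delta> \<and> w = reflection_word \<alpha>s"
  using assms
proof (induction rule: weyl_group.induct)
  case id
  show ?case by (rule exI[of _ "[]"]) simp
next
  case (reflect \<beta> w)
  obtain \<alpha>s where \<alpha>s: "set \<alpha>s \<subseteq> \<Delta>" "reflection \<beta> = reflection_word \<alpha>s"
    using positive_reflection_word[of \<beta>] positive_reflection_word[of "- \<beta>"]
      reflect.hyps(1) root_uminus[of \<beta>] positive_uminus[of \<beta>] reflection_uminus[of \<beta>]
    by metis
  obtain \<beta>s where "set \<beta>s \<subseteq> \<Delta>" "w = reflection_word \<beta>s"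
    using reflect.IH by blast
  with \<alpha>s have "set (\<alpha>s @ \<beta>s) \<subseteq> \<Delta>" "reflection \<beta> \<circ> w = reflection_word (\<alpha>s @ \<beta>s)"
    by simp_all
  then show ?case by blast
qed

lemma reflection_word_weyl_group: "set \<alpha>s \<subseteq> \<Delta> \<Longrightarrow> reflection_word \<alpha>s \<in> weyl_group \<Phi>"
  by (induction \<alpha>s) (auto intro: weyl_group.intros simple_root)

lemma shortest_word:
  assumes "w \<in> weyl_group \<Phi>"
  obtains \<alpha>s where "set \<alpha>s \<subseteq> \<Delta>" "w = reflection_word \<alpha>s" "length \<alpha>s = weyl_length \<Delta> w"
proof -
  have "\<exists>n \<alpha>s. length \<alpha>s = n \<and> set \<alpha>s \<subseteq> \<Delta> \<and> w = reflection_word \<alpha>s"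
    using weyl_group_reflection_word[OF assms] by blast
  from LeastI_ex[OF this] show ?thesis
    using that unfolding weyl_length_def reflection_word_def by blast
qed

lemma weyl_length_word_le: "set \<alpha>s \<subseteq> \<Delta> \<Longrightarrow> weyl_length \<Delta> (reflection_word \<alpha>s) \<le> length \<alpha>s"
  unfolding weyl_length_def reflection_word_def by (rule Least_le) blast

lemma simple_comp_weyl_group:
  "\<alpha> \<in> \<Delta> \<Longrightarrow> w \<in> weyl_group \<Phi> \<Longrightarrow> reflection \<alpha> \<circ> w \<in> weyl_group \<Phi>"
  by (intro weyl_group.reflect simple_root)

lemma simple_reflection_weyl_group: "\<alpha> \<in> \<Delta> \<Longrightarrow> reflection \<alpha> \<in> weyl_group \<Phi>"
  using simple_comp_weyl_group[OF _ weyl_group.id] by simp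

lemma simple_reflection_cancel: "\<alpha> \<in> \<Delta> \<Longrightarrow> reflection \<alpha> \<circ> (reflection \<alpha> \<circ> w) = w"
  by (auto simp: fun_eq_iff intro!: reflection_involutive dest: simple_root root_nonzero)

lemma weyl_length_simple_comp_le:
  assumes "\<alpha> \<in> \<Delta>" "w \<in> weyl_group \<Phi>"
  shows "weyl_length \<Delta> (reflection \<alpha> \<circ> w) \<le> Suc (weyl_length \<Delta> w)"
proof -
  obtain \<alpha>s where "set \<alpha>s \<subseteq> \<Delta>" "w = reflection_word \<alpha>s" "length \<alpha>s = weyl_length \<Delta> w"
    using shortest_word[OF assms(2)] .
  then show ?thesis using weyl_length_word_le[of "\<alpha> # \<alpha>s"] assms(1) by simp
qed

lemma weyl_length_id: "weyl_length \<Delta> id = 0"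
  using weyl_length_word_le[of "[]"] by simp

lemma weyl_group_inv:
  assumes "w \<in> weyl_group \<Phi>"
  shows "inv w \<in> weyl_group \<Phi>" "bij w" "weyl_length \<Delta> (inv w) \<le> weyl_length \<Delta> w"
proof -
  obtain \<alpha>s where \<alpha>s: "set \<alpha>s \<subseteq> \<Delta>" "w = reflection_word \<alpha>s" "length \<alpha>s = weyl_length \<Delta> w"
    using shortest_word[OF assms] .
  then have "0 \<notin> set \<alpha>s" using simple_root root_nonzero by blast
  then have 1: "reflection_word (rev \<alpha>s) \<circ> w = id" and 2: "w \<circ> reflection_word (rev \<alpha>s) = id"
    using reflection_word_rev[of \<alpha>s] reflection_word_rev[of "rev \<alpha>s"] \<alpha>s by (auto simp: fun_eq_iff)
  then show "bij w" using o_bij by blast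
  have inv: "inv w = reflection_word (rev \<alpha>s)" using inv_unique_comp[OF 2 1] .
  show "inv w \<in> weyl_group \<Phi>"
    unfolding inv using \<alpha>s(1) by (intro reflection_word_weyl_group) simp
  show "weyl_length \<Delta> (inv w) \<le> weyl_length \<Delta> w"
    unfolding inv using weyl_length_word_le[of "rev \<alpha>s"] \<alpha>s by simp
qed

lemma weyl_length_inv: "w \<in> weyl_group \<Phi> \<Longrightarrow> weyl_length \<Delta> (inv w) = weyl_length \<Delta> w"
  using weyl_group_inv[of w] weyl_group_inv[of "inv w"] by (simp add: inv_inv_eq)

lemma linear_weyl_group: "w \<in> weyl_group \<Phi> \<Longrightarrow> linear w"
proof (induction rule: weyl_group.induct)
  case id
  show ?case by (rule linearI) simp_all
next
  case (reflect \<alpha> w)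
  show ?case using linear_compose[OF reflect.IH linear_reflection] .
qed

lemma weyl_group_preserves_roots: "w \<in> weyl_group \<Phi> \<Longrightarrow> \<alpha> \<in> \<Phi> \<Longrightarrow> w \<alpha> \<in> \<Phi>"
  by (induction rule: weyl_group.induct) (auto intro: reflection_root)

definition root_sign :: "'a \<Rightarrow> int" where
  "root_sign \<beta> = (if positive \<beta> then 1 else -1)"

text \<open>This is \<open>-1\<close> to the number of positive roots that \<open>w\<close> makes negative, and it equals the
  determinant of \<open>w\<close>.\<close>

definition weyl_sign :: "('a \<Rightarrow> 'a) \<Rightarrow> int" where
  "weyl_sign w = (\<Prod>\<beta> | \<beta> \<in> \<Phi> \<and> positive \<beta>. root_sign (w \<beta>))"

text \<open>Exactly one positive root is mapped by \<open>w\<close> to \<open>\<alpha>\<close> or \<open>-\<alpha>\<close>, and these are the only roots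
  whose sign is changed by the simple reflection at \<open>\<alpha>\<close>.\<close>

lemma weyl_sign_simple_comp:
  assumes "\<alpha> \<in> \<Delta>" and w: "w \<in> weyl_group \<Phi>"
  shows "weyl_sign (reflection \<alpha> \<circ> w) = - weyl_sign w"
proof -
  let ?P = "{\<beta> \<in> \<Phi>. positive \<beta>}"
  have \<alpha>: "\<alpha> \<in> \<Phi>" "positive \<alpha>" "\<alpha> \<noteq> 0"
    using assms simple_root positive_simple root_nonzero by auto
  have lin: "linear w" and inj: "inj w"
    using w linear_weyl_group weyl_group_inv(2) bij_is_inj by auto
  have "inv w \<alpha> \<in> \<Phi>" "w (inv w \<alpha>) = \<alpha>"
    using w \<alpha> weyl_group_inv weyl_group_preserves_roots by (auto simp: bij_is_surj surj_f_inv_f)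
  then obtain \<beta> where \<beta>: "\<beta> \<in> ?P" "w \<beta> = \<alpha> \<or> w \<beta> = - \<alpha>"
    using positive_uminus[of "inv w \<alpha>"] root_uminus[of "inv w \<alpha>"] linear_neg[OF lin, of "inv w \<alpha>"]
    by (cases "positive (inv w \<alpha>)") auto
  have other: "w \<gamma> \<noteq> \<alpha>" "w \<gamma> \<noteq> - \<alpha>" if "\<gamma> \<in> ?P - {\<beta>}" for \<gamma>
  proof -
    have "\<gamma> \<noteq> \<beta>" "\<gamma> \<noteq> - \<beta>"
      using that \<beta>(1) positive_uminus[of \<beta>] by auto
    then have "w \<gamma> \<noteq> w \<beta>" "w \<gamma> \<noteq> - w \<beta>"
      using inj linear_neg[OF lin, of \<beta>] by (metis injD)+
    then show "w \<gamma> \<noteq> \<alpha>" "w \<gamma> \<noteq> - \<alpha>" using \<beta>(2) by auto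
  qed
  have fin: "finite ?P" using finite_roots by simp
  have flip: "root_sign (reflection \<alpha> (w \<beta>)) = - root_sign (w \<beta>)"
    using \<beta>(2) \<alpha> positive_uminus[of \<alpha>]
    by (auto simp: root_sign_def reflection_self linear_neg[OF linear_reflection])
  have "weyl_sign (reflection \<alpha> \<circ> w) =
      root_sign (reflection \<alpha> (w \<beta>)) * (\<Prod>\<gamma>\<in>?P - {\<beta>}. root_sign (reflection \<alpha> (w \<gamma>)))"
    unfolding weyl_sign_def using prod.remove[OF fin \<beta>(1)] by simp
  also have "(\<Prod>\<gamma>\<in>?P - {\<beta>}. root_sign (reflection \<alpha> (w \<gamma>))) = (\<Prod>\<gamma>\<in>?P - {\<beta>}. root_sign (w \<gamma>))"
    using other w assms(1)
    by (intro prod.cong refl)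
      (simp add: root_sign_def positive_simple_reflection weyl_group_preserves_roots)
  also have "root_sign (reflection \<alpha> (w \<beta>)) * \<dots> = - weyl_sign w"
    unfolding weyl_sign_def prod.remove[OF fin \<beta>(1)] using flip by simp
  finally show ?thesis .
qed

lemma weyl_sign_eq_length:
  assumes "w \<in> weyl_group \<Phi>"
  shows "weyl_sign w = (-1) ^ weyl_length \<Delta> w"
proof -
  have "weyl_sign (reflection_word \<alpha>s) = (-1) ^ length \<alpha>s" if "set \<alpha>s \<subseteq> \<Delta>" for \<alpha>s
    using that
  proof (induction \<alpha>s)
    case Nil
    then show ?case by (simp add: weyl_sign_def root_sign_def)
  next
    case (Cons \<alpha> \<alpha>s)
    then show ?case
      using weyl_sign_simple_comp[of \<alpha> "reflection_word \<alpha>s"] reflection_word_weyl_group[of \<alpha>s]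
      by (simp add: o_def)
  qed
  then show ?thesis using shortest_word[OF assms] by metis
qed

text \<open>A word for \<open>w\<close> yields one for \<open>s\<^sub>\<alpha> w\<close> with one more letter, and conversely; equal lengths are
  excluded because the sign changes.\<close>

lemma weyl_length_simple_comp:
  assumes "\<alpha> \<in> \<Delta>" "w \<in> weyl_group \<Phi>"
  shows "weyl_length \<Delta> (reflection \<alpha> \<circ> w) = Suc (weyl_length \<Delta> w) \<or>
    weyl_length \<Delta> w = Suc (weyl_length \<Delta> (reflection \<alpha> \<circ> w))"
proof -
  let ?w = "reflection \<alpha> \<circ> w"
  note sw = simple_comp_weyl_group[OF assms]
  have "weyl_length \<Delta> ?w \<le> Suc (weyl_length \<Delta> w)"
    using weyl_length_simple_comp_le[OF assms] .
  moreover have "weyl_length \<Delta> w \<le> Suc (weyl_length \<Delta> ?w)"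
    using weyl_length_simple_comp_le[OF assms(1) sw] unfolding simple_reflection_cancel[OF assms(1)] .
  moreover have "(-1) ^ weyl_length \<Delta> ?w = - ((-1 :: int) ^ weyl_length \<Delta> w)"
    using weyl_sign_simple_comp[OF assms] weyl_sign_eq_length[OF sw]
      weyl_sign_eq_length[OF assms(2)] by simp
  then have "weyl_length \<Delta> ?w \<noteq> weyl_length \<Delta> w"
    by (metis equal_neg_zero power_not_zero zero_neq_neg_one)
  ultimately show ?thesis by linarith
qed

lemma weyl_length_simple_reflection: "\<alpha> \<in> \<Delta> \<Longrightarrow> weyl_length \<Delta> (reflection \<alpha>) = 1"
  using weyl_length_simple_comp[OF _ weyl_group.id] by (simp add: weyl_length_id)

text \<open>Induction along a reduced word, adding simple reflections on the left.\<close>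

lemma weyl_group_length_induct [consumes 1, case_names id step]:
  assumes "w \<in> weyl_group \<Phi>"
    and "P id"
    and "\<And>\<alpha> w. \<lbrakk>\<alpha> \<in> \<Delta>; w \<in> weyl_group \<Phi>;
        weyl_length \<Delta> (reflection \<alpha> \<circ> w) = Suc (weyl_length \<Delta> w); P w\<rbrakk>
      \<Longrightarrow> P (reflection \<alpha> \<circ> w)"
  shows "P w"
  using assms(1)
proof (induction "weyl_length \<Delta> w" arbitrary: w)
  case 0
  obtain \<alpha>s where "w = reflection_word \<alpha>s" "length \<alpha>s = weyl_length \<Delta> w"
    using shortest_word[OF 0(2)] .
  then have "w = id" using 0(1) by simp
  then show ?case using assms(2) by (simp only:)
next
  case (Suc n)
  obtain \<alpha>s where \<alpha>s: "set \<alpha>s \<subseteq> \<Delta>" "w = reflection_word \<alpha>s" "length \<alpha>s = weyl_length \<Delta> w"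
    using shortest_word[OF Suc.prems] .
  then obtain \<alpha> \<beta>s where "\<alpha>s = \<alpha> # \<beta>s" using Suc.hyps(2) by (cases \<alpha>s) auto
  with \<alpha>s have w: "w = reflection \<alpha> \<circ> reflection_word \<beta>s" and \<alpha>: "\<alpha> \<in> \<Delta>" "set \<beta>s \<subseteq> \<Delta>"
    and len: "Suc (length \<beta>s) = weyl_length \<Delta> w" by auto
  have mem: "reflection_word \<beta>s \<in> weyl_group \<Phi>" using reflection_word_weyl_group \<alpha>(2) .
  have "weyl_length \<Delta> (reflection_word \<beta>s) \<le> length \<beta>s" using weyl_length_word_le \<alpha>(2) .
  then have "weyl_length \<Delta> w = Suc (weyl_length \<Delta> (reflection_word \<beta>s))"
    using weyl_length_simple_comp_le[OF \<alpha>(1) mem] w len by simp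
  then show ?case using assms(3)[OF \<alpha>(1) mem] Suc.hyps mem w by simp
qed

end

section \<open>Polynomials with natural coefficients\<close>

lemma nat_poly_in_0: "nat_poly_in x 0"
  unfolding nat_poly_in_def by (rule exI[of _ 0]) simp

lemma nat_poly_in_1: "nat_poly_in x 1"
  unfolding nat_poly_in_def by (rule exI[of _ 1]) simp

lemma nat_poly_in_add:
  assumes "nat_poly_in x f" "nat_poly_in x g"
  shows "nat_poly_in x (f + g)"
proof -
  obtain p r :: "nat poly" where
    "f = poly (map_poly of_nat p) x" "g = poly (map_poly of_nat r) x"
    using assms unfolding nat_poly_in_def by blast
  moreover have "(map_poly of_nat (p + r) :: rat poly fract poly) =
      map_poly of_nat p + map_poly of_nat r"
    by (rule poly_eqI) (simp add: coeff_map_poly)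
  ultimately show ?thesis
    unfolding nat_poly_in_def by (intro exI[of _ "p + r"]) simp
qed

lemma nat_poly_in_mult_variable:
  assumes "nat_poly_in x f"
  shows "nat_poly_in x (x * f)"
proof -
  obtain p :: "nat poly" where "f = poly (map_poly of_nat p) x"
    using assms unfolding nat_poly_in_def by blast
  then show ?thesis
    unfolding nat_poly_in_def by (intro exI[of _ "pCons 0 p"]) (simp add: map_poly_pCons)
qed

lemma nat_poly_in_if: "nat_poly_in x f \<Longrightarrow> nat_poly_in x g \<Longrightarrow> nat_poly_in x (if b then f else g)"
  by simp

lemma nat_poly_in_sum: "(\<And>i. i \<in> I \<Longrightarrow> nat_poly_in x (f i)) \<Longrightarrow> nat_poly_in x (sum f I)"
  by (induction I rule: infinite_finite_induct) (auto intro: nat_poly_in_0 nat_poly_in_add)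

lemma bar_nat_poly_in:
  assumes "nat_poly_in x f" "bar x = x"
  shows "bar f = f"
proof -
  have bar_0: "bar 0 = 0" and bar_1: "bar 1 = 1"
    using bar_of_rat[of 0] bar_of_rat[of 1] by (simp_all flip: one_pCons)
  have bar_of_nat: "bar (of_nat n) = of_nat n" for n
    by (induction n) (simp_all add: bar_0 bar_1 bar_hom)
  have "bar (poly (map_poly of_nat p) x) = poly (map_poly of_nat p) x" for p :: "nat poly"
    by (induction p) (simp_all add: map_poly_pCons bar_0 bar_hom bar_of_nat assms(2))
  then show ?thesis using assms(1) unfolding nat_poly_in_def by auto
qed

text \<open>\<open>v - v\<^sup>-\<^sup>1\<close> is the sum of \<open>v\<close> and its image under the involution \<open>bar\<close>.\<close>

lemma bar_indet_minus_inverse: "bar (indet - inverse indet) = indet - inverse indet"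
  using bar_hom(1)[of indet "bar indet"] bar_bar[of indet] by (simp add: bar_indet)

lemma indet_nonzero: "indet \<noteq> 0"
  by (simp add: indet_def)

lemma indet_powi:
  "indet powi (k + 1) = indet powi k * indet"
  "indet powi (k - 1) = indet powi k * inverse indet"
  using indet_nonzero by (simp_all add: power_int_add power_int_diff divide_inverse)

lemma q_embed_0: "q_embed 0 = 0" and q_embed_1: "q_embed 1 = 1"
  using q_embed_of_rat[of 0] q_embed_of_rat[of 1] by (simp_all flip: one_pCons)

lemma q_embed_diff: "q_embed (f - g) = q_embed f - q_embed g"
  using q_embed_hom(1)[of "f - g" g] by simp

lemma q_embed_sum: "q_embed (sum f I) = (\<Sum>i\<in>I. q_embed (f i))"
  by (induction I rule: infinite_finite_induct) (simp_all add: q_embed_0 q_embed_hom)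

lemma q_embed_minus_one_power: "q_embed ((-1) ^ n * f) = (-1) ^ n * q_embed f"
proof (induction n)
  case (Suc n)
  then show ?case using q_embed_diff[of 0 "(-1) ^ n * f"] by (simp add: q_embed_0)
qed simp

section \<open>Normalized coefficients in the Iwahori-Hecke algebra\<close>

context iwahori_hecke_algebra
begin

definition coeff_T :: "'h \<Rightarrow> ('a \<Rightarrow> 'a) \<Rightarrow> rat poly fract" where
  "coeff_T h z = representation (T ` W) h (T z)"

lemma coeff_T_T:
  assumes "y \<in> W" "z \<in> W"
  shows "coeff_T (T y) z = (if y = z then 1 else 0)"
  using assms T_inj unfolding coeff_T_def
  by (subst representation_basis[OF T_independent]) (auto simp: inj_on_eq_iff)

lemma coeff_T_add: "coeff_T (g + h) z = coeff_T g z + coeff_T h z"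
  unfolding coeff_T_def by (subst representation_add[OF T_independent]) (simp_all add: T_span)

lemma coeff_T_diff: "coeff_T (g - h) z = coeff_T g z - coeff_T h z"
  unfolding coeff_T_def by (subst representation_diff[OF T_independent]) (simp_all add: T_span)

lemma coeff_T_scale: "coeff_T (scale c h) z = c * coeff_T h z"
  unfolding coeff_T_def by (subst representation_scale[OF T_independent]) (simp_all add: T_span)

lemma coeff_T_0: "coeff_T 0 z = 0"
  unfolding coeff_T_def by (simp add: representation_zero)

lemma linear_induct_T [case_names T add scale zero]:
  assumes "\<And>y. y \<in> W \<Longrightarrow> P (T y)"
    and "\<And>g h. P g \<Longrightarrow> P h \<Longrightarrow> P (g + h)"
    and "\<And>c h. P h \<Longrightarrow> P (scale c h)"
    and "P 0"
  shows "P h"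
proof -
  have "h \<in> span (T ` W)" using T_span by simp
  then show ?thesis
    by (induction rule: span_induct_alt) (auto intro: assms)
qed

text \<open>The relations give only that \<open>T id\<close> fixes each basis element; it is the unit because the basis
  spans the algebra.\<close>

lemma T_id: "T id = 1"
proof -
  have unit: "T id * T y = T y" if "y \<in> W" for y
    using T_mult[OF weyl_group.id that] by (simp add: weyl_length_id)
  define e where "e = T id"
  have "e * h = h" for h
    by (induction h rule: linear_induct_T)
      (simp_all add: unit[folded e_def] distrib_left scale_mult_right)
  from this[of 1] show ?thesis by (simp add: e_def)
qed

text \<open>The unfolded forms serve goals in which the simplifier has replaced \<open>id\<close> by an abstraction.\<close>

lemmas id_unit = weyl_length_id T_id weyl_length_id[unfolded id_def] T_id[unfolded id_def]

lemma T_simple_square: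
  assumes "\<alpha> \<in> \<Delta>"
  shows "T (reflection \<alpha>) * T (reflection \<alpha>) = scale (indet - 1) (T (reflection \<alpha>)) + scale indet 1"
proof -
  let ?t = "T (reflection \<alpha>)"
  have "(?t - scale indet 1) * (?t + 1) = 0"
    using T_quadratic simple_reflection_weyl_group weyl_length_simple_reflection assms by simp
  then show ?thesis
    by (simp add: algebra_simps scale_mult_left scale_left_diff_distrib)
qed

lemma T_simple_mult_up:
  assumes "\<alpha> \<in> \<Delta>" "w \<in> W" "len (reflection \<alpha> \<circ> w) = Suc (len w)"
  shows "T (reflection \<alpha>) * T w = T (reflection \<alpha> \<circ> w)"
  using T_mult[OF simple_reflection_weyl_group[OF assms(1)] assms(2)]
    assms(3) weyl_length_simple_reflection[OF assms(1)] by simp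

lemma T_simple_mult_down:
  assumes "\<alpha> \<in> \<Delta>" "w \<in> W" "len w = Suc (len (reflection \<alpha> \<circ> w))"
  shows "T (reflection \<alpha>) * T w = scale (indet - 1) (T w) + scale indet (T (reflection \<alpha> \<circ> w))"
proof -
  let ?s = "reflection \<alpha>"
  have up: "T ?s * T (?s \<circ> w) = T w"
    using T_simple_mult_up[OF assms(1) simple_comp_weyl_group[OF assms(1,2)]] assms(3)
      simple_reflection_cancel[OF assms(1), of w] by simp
  have "T ?s * T w = (T ?s * T ?s) * T (?s \<circ> w)"
    by (simp add: mult.assoc up)
  also have "\<dots> = scale (indet - 1) (T w) + scale indet (T (?s \<circ> w))"
    by (simp add: T_simple_square[OF assms(1)] distrib_right scale_mult_left up)
  finally show ?thesis .
qed

text \<open>Read off at \<open>z\<close>, a product with \<open>T\<^sub>s\<close> only sees the coefficients at \<open>z\<close> and \<open>sz\<close>. The diagonal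
  term \<open>q - 1\<close> is present exactly when \<open>sz\<close> is shorter than \<open>z\<close>.\<close>

lemma coeff_T_simple_mult:
  assumes "\<alpha> \<in> \<Delta>" "z \<in> W"
  shows "coeff_T (T (reflection \<alpha>) * h) z =
    (if len (reflection \<alpha> \<circ> z) = Suc (len z) then indet * coeff_T h (reflection \<alpha> \<circ> z)
     else coeff_T h (reflection \<alpha> \<circ> z) + (indet - 1) * coeff_T h z)"
proof -
  let ?s = "reflection \<alpha>"
  \<comment> \<open>Opaque names for \<open>sz\<close> and \<open>sy\<close> keep the simplifier from unfolding the compositions.\<close>
  define u where "u = ?s \<circ> z"
  have u: "u \<in> W" "?s \<circ> u = z"
    using simple_comp_weyl_group[OF assms] simple_reflection_cancel[OF assms(1), of z]
    by (simp_all only: u_def)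
  have "coeff_T (T ?s * h) z =
    (if len u = Suc (len z) then indet * coeff_T h u
     else coeff_T h u + (indet - 1) * coeff_T h z)"
  proof (induction h rule: linear_induct_T)
    case (T y)
    define x where "x = ?s \<circ> y"
    have x: "x \<in> W" "?s \<circ> x = y"
      using simple_comp_weyl_group[OF assms(1) T] simple_reflection_cancel[OF assms(1), of y]
      by (simp_all only: x_def)
    have xz: "x = z \<longleftrightarrow> y = u" and xu: "x = u \<longleftrightarrow> y = z"
      using x(2) u(2) u_def x_def by metis+
    then have coeff: "coeff_T (T x) z = (if y = u then 1 else 0)"
      "coeff_T (T y) u = (if y = u then 1 else 0)" "coeff_T (T y) z = (if y = z then 1 else 0)"
      using T assms(2) x(1) u(1) by (simp_all only: coeff_T_T)
    have "len x = Suc (len y) \<or> len y = Suc (len x)"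
      unfolding x_def using weyl_length_simple_comp[OF assms(1) T] .
    then show ?case
    proof
      assume up: "len x = Suc (len y)"
      have mult: "T ?s * T y = T x"
        using T_simple_mult_up[OF assms(1) T up[unfolded x_def]] by (simp only: x_def)
      show ?thesis
      proof (cases "len u = Suc (len z)")
        case True
        then have "y \<noteq> u" using up xz by auto
        with True show ?thesis unfolding mult coeff by simp
      next
        case False
        then have "y \<noteq> z" using up xu by blast
        with False show ?thesis unfolding mult coeff by simp
      qed
    next
      assume down: "len y = Suc (len x)"
      have mult: "T ?s * T y = scale (indet - 1) (T y) + scale indet (T x)"
        using T_simple_mult_down[OF assms(1) T down[unfolded x_def]] by (simp only: x_def)
      show ?thesis
      proof (cases "len u = Suc (len z)")
        case True
        then have "y \<noteq> z" using down xu by auto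
        with True show ?thesis unfolding mult coeff_T_add coeff_T_scale coeff by simp
      next
        case False
        then have "y \<noteq> u" using down xz by blast
        with False show ?thesis unfolding mult coeff_T_add coeff_T_scale coeff by simp
      qed
    qed
  qed (simp_all add: coeff_T_add coeff_T_scale coeff_T_0 distrib_left scale_mult_right algebra_simps)
  then show ?thesis unfolding u_def .
qed

text \<open>The coefficient of \<open>v\<^sup>-\<^sup>n h\<close> at the rescaled basis element \<open>v\<^sup>-\<^sup>|\<^sup>z\<^sup>| T\<^sub>z\<close>. The parameter \<open>n\<close> is the
  power of \<open>v\<close> that \<open>h\<close> has accumulated, one for each simple factor.\<close>

definition normal_coeff :: "nat \<Rightarrow> 'h \<Rightarrow> ('a \<Rightarrow> 'a) \<Rightarrow> rat poly fract" where
  "normal_coeff n h z = indet powi (- int n + int (len z)) * q_embed (coeff_T h z)"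

text \<open>The normalization turns the weights \<open>1\<close> and \<open>q\<close> at \<open>sz\<close> both into \<open>1\<close>, and the weight \<open>q - 1\<close>
  at \<open>z\<close> into \<open>v - v\<^sup>-\<^sup>1\<close>.\<close>

lemma normal_coeff_simple_mult:
  assumes "\<alpha> \<in> \<Delta>" "z \<in> W"
  shows "normal_coeff (Suc n) (T (reflection \<alpha>) * h) z = normal_coeff n h (reflection \<alpha> \<circ> z) +
    (if len (reflection \<alpha> \<circ> z) = Suc (len z) then 0
     else (indet - inverse indet) * normal_coeff n h z)"
proof -
  let ?m = "- int n + int (len z)"
  note embed = q_embed_hom q_embed_diff q_embed_indet q_embed_1
  show ?thesis
    using weyl_length_simple_comp[OF assms]
  proof
    assume up: "len (reflection \<alpha> \<circ> z) = Suc (len z)"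
    have e: "- int (Suc n) + int (len z) = ?m - 1"
      "- int n + int (len (reflection \<alpha> \<circ> z)) = ?m + 1" using up by simp_all
    show ?thesis
      unfolding normal_coeff_def coeff_T_simple_mult[OF assms] e indet_powi using up indet_nonzero
      by (simp add: embed power2_eq_square field_simps)
  next
    assume down: "len z = Suc (len (reflection \<alpha> \<circ> z))"
    have e: "- int (Suc n) + int (len z) = ?m - 1"
      "- int n + int (len (reflection \<alpha> \<circ> z)) = ?m - 1" using down by simp_all
    show ?thesis
      unfolding normal_coeff_def coeff_T_simple_mult[OF assms] e indet_powi using down indet_nonzero
      by (simp add: embed power2_eq_square field_simps)
  qed
qed

text \<open>The scalar \<open>q - 1\<close> contributes \<open>v - v\<^sup>-\<^sup>1\<close> at every \<open>z\<close>; for \<open>sz\<close> shorter than \<open>z\<close> the diagonal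
  term of \<open>T\<^sub>s\<close> cancels it. The sign at \<open>sz\<close> is absorbed by the signed basis, as \<open>|sz|\<close> and \<open>|z|\<close>
  differ in parity.\<close>

lemma normal_coeff_opposite_simple_mult:
  assumes "\<alpha> \<in> \<Delta>" "z \<in> W"
  shows "normal_coeff (Suc n) ((scale (indet - 1) 1 - T (reflection \<alpha>)) * h) z =
    - normal_coeff n h (reflection \<alpha> \<circ> z) +
    (if len (reflection \<alpha> \<circ> z) = Suc (len z) then (indet - inverse indet) * normal_coeff n h z
     else 0)"
proof -
  have scale: "normal_coeff (Suc n) (scale (indet - 1) h) z =
      (indet - inverse indet) * normal_coeff n h z"
  proof -
    have e: "- int (Suc n) + int (len z) = - int n + int (len z) - 1" by simp
    show ?thesis
      unfolding normal_coeff_def e indet_powi(2) coeff_T_scale using indet_nonzero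
      by (simp add: q_embed_hom q_embed_diff q_embed_indet q_embed_1
          power2_eq_square field_simps)
  qed
  have "normal_coeff (Suc n) ((scale (indet - 1) 1 - T (reflection \<alpha>)) * h) z =
      normal_coeff (Suc n) (scale (indet - 1) h) z - normal_coeff (Suc n) (T (reflection \<alpha>) * h) z"
    by (simp add: normal_coeff_def left_diff_distrib scale_mult_left coeff_T_diff q_embed_diff
        right_diff_distrib)
  then show ?thesis
    unfolding scale normal_coeff_simple_mult[OF assms] by simp
qed

lemma normal_coeff_T:
  "y \<in> W \<Longrightarrow> z \<in> W \<Longrightarrow> normal_coeff (len y) (T y) z = (if y = z then 1 else 0)"
  by (simp add: normal_coeff_def coeff_T_T q_embed_0 q_embed_1)

section \<open>Positivity\<close>

lemma nat_poly_in_structure_coeff: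
  assumes "w \<in> W" "y \<in> W" "z \<in> W"
  shows "nat_poly_in (indet - inverse indet) (normal_coeff (len w + len y) (T w * T y) z)"
  using assms(1,3)
proof (induction arbitrary: z rule: weyl_group_length_induct)
  case id
  then show ?case
    using normal_coeff_T[OF assms(2), of z]
    by (simp add: id_unit nat_poly_in_0 nat_poly_in_1)
next
  case (step \<alpha> w)
  have mult: "T (reflection \<alpha> \<circ> w) * T y = T (reflection \<alpha>) * (T w * T y)"
    using T_simple_mult_up[OF step.hyps] by (simp flip: mult.assoc)
  show ?case
    unfolding step.hyps(3) add_Suc mult normal_coeff_simple_mult[OF step.hyps(1) step.prems]
    by (intro nat_poly_in_add nat_poly_in_if nat_poly_in_0 nat_poly_in_mult_variable
        step.IH step.prems simple_comp_weyl_group[OF step.hyps(1) step.prems])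
qed

lemma tau_tilde_eq_sum:
  "tau_tilde w = (\<Sum>y\<in>W. normal_coeff (len w + len y) (T w * T y) y)"
proof -
  have "tau w = (\<Sum>y\<in>W. coeff_T (T w * T y) y)"
    unfolding tau_def trace_basis_def coeff_T_def by (simp add: sum.reindex[OF T_inj])
  then show ?thesis
    by (simp add: tau_tilde_def normal_coeff_def q_embed_sum sum_distrib_left)
qed

lemma nat_poly_in_tau_tilde:
  "w \<in> W \<Longrightarrow> nat_poly_in (indet - inverse indet) (tau_tilde w)"
  unfolding tau_tilde_eq_sum by (intro nat_poly_in_sum nat_poly_in_structure_coeff)

lemma ring_inverse_eqI:
  fixes x y :: 'h
  assumes "x * y = 1" "y * x = 1"
  shows "ring_inverse x = y"
  unfolding ring_inverse_def
proof (rule the_equality)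
  show "x * y = 1 \<and> y * x = 1" using assms by simp
  fix y' assume "x * y' = 1 \<and> y' * x = 1"
  then show "y' = y" using assms by (metis mult.assoc mult_1_left mult_1_right)
qed

lemma T_inv_simple_comp:
  assumes "\<alpha> \<in> \<Delta>" "w \<in> W" "len (reflection \<alpha> \<circ> w) = Suc (len w)"
  shows "T (inv (reflection \<alpha> \<circ> w)) = T (inv w) * T (reflection \<alpha>)"
proof -
  let ?s = "reflection \<alpha>"
  have "inv ?s = ?s"
    using simple_reflection_cancel[OF assms(1), of id] by (intro inv_unique_comp) simp_all
  then have inv: "inv (?s \<circ> w) = inv w \<circ> ?s"
    using o_inv_distrib weyl_group_inv(2) simple_reflection_weyl_group assms by metis
  have "len (inv w \<circ> ?s) = len (inv w) + len ?s"
    using weyl_length_inv[OF simple_comp_weyl_group[OF assms(1,2)]] weyl_length_inv[OF assms(2)]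
      assms(3) weyl_length_simple_reflection[OF assms(1)] by (simp add: inv)
  then show ?thesis
    unfolding inv
    using T_mult[OF weyl_group_inv(1)[OF assms(2)] simple_reflection_weyl_group[OF assms(1)]] by simp
qed

lemma T_simple_inverse:
  assumes "\<alpha> \<in> \<Delta>"
  defines "u \<equiv> scale (inverse indet) (T (reflection \<alpha>) - scale (indet - 1) 1)"
  shows "T (reflection \<alpha>) * u = 1" "u * T (reflection \<alpha>) = 1"
  using T_simple_square[OF assms(1)] indet_nonzero
  by (simp_all add: u_def scale_mult_left scale_mult_right left_diff_distrib right_diff_distrib)

lemma T_inv_invertible:
  assumes "w \<in> W"
  shows "T (inv w) * ring_inverse (T (inv w)) = 1 \<and> ring_inverse (T (inv w)) * T (inv w) = 1"
proof -
  have "\<exists>x. T (inv w) * x = 1 \<and> x * T (inv w) = 1"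
    using assms
  proof (induction rule: weyl_group_length_induct)
    case id
    show ?case by (simp add: id_unit)
  next
    case (step \<alpha> w)
    then obtain x where x: "T (inv w) * x = 1" "x * T (inv w) = 1" by blast
    obtain u where u: "T (reflection \<alpha>) * u = 1" "u * T (reflection \<alpha>) = 1"
      using T_simple_inverse[OF step.hyps(1)] by blast
    have "T (inv w) * T (reflection \<alpha>) * (u * x) = 1" "u * x * (T (inv w) * T (reflection \<alpha>)) = 1"
      using x u by (metis mult.assoc mult_1_left)+
    then show ?case unfolding T_inv_simple_comp[OF step.hyps] by blast
  qed
  then show ?thesis using ring_inverse_eqI by blast
qed

text \<open>The left-hand side of the equation that defines \<open>R\<close>.\<close>

definition opposite_T :: "('a \<Rightarrow> 'a) \<Rightarrow> 'h" where
  "opposite_T w = scale ((- indet) ^ len w) (ring_inverse (T (inv w)))"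

text \<open>A reduced word of \<open>w\<^sup>-\<^sup>1\<close> is that of \<open>w\<close> reversed, and inversion reverses it again, so the new
  factor appears on the left: it is \<open>-q\<close> times the inverse of \<open>T\<^sub>s\<close>.\<close>

lemma opposite_T_simple_comp:
  assumes "\<alpha> \<in> \<Delta>" "w \<in> W" "len (reflection \<alpha> \<circ> w) = Suc (len w)"
  shows "opposite_T (reflection \<alpha> \<circ> w) =
    (scale (indet - 1) 1 - T (reflection \<alpha>)) * opposite_T w"
proof -
  define u where "u = scale (inverse indet) (T (reflection \<alpha>) - scale (indet - 1) 1)"
  let ?x = "ring_inverse (T (inv w))"
  have u: "T (reflection \<alpha>) * u = 1" "u * T (reflection \<alpha>) = 1"
    unfolding u_def using T_simple_inverse[OF assms(1)] by simp_all
  have x: "T (inv w) * ?x = 1" "?x * T (inv w) = 1"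
    using T_inv_invertible[OF assms(2)] by simp_all
  have "ring_inverse (T (inv (reflection \<alpha> \<circ> w))) = u * ?x"
    unfolding T_inv_simple_comp[OF assms] using x u
    by (intro ring_inverse_eqI) (metis mult.assoc mult_1_left)+
  then have "opposite_T (reflection \<alpha> \<circ> w) = scale (- indet) u * opposite_T w"
    by (simp add: opposite_T_def assms(3) scale_mult_left scale_mult_right)
  also have "scale (- indet) u = scale (indet - 1) 1 - T (reflection \<alpha>)"
    using indet_nonzero by (simp add: u_def)
  finally show ?thesis .
qed

lemma nat_poly_in_opposite_coeff:
  assumes "w \<in> W" "z \<in> W"
  shows "nat_poly_in (indet - inverse indet) ((-1) ^ len z * normal_coeff (len w) (opposite_T w) z)"
  using assms
proof (induction arbitrary: z rule: weyl_group_length_induct)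
  case id
  have "opposite_T id = T id"
    using ring_inverse_eqI[of 1 1] by (simp add: opposite_T_def weyl_length_id T_id)
  then show ?case
    using normal_coeff_T[OF weyl_group.id id] by (auto simp: id_def id_unit nat_poly_in_0 nat_poly_in_1)
next
  case (step \<alpha> w)
  let ?s = "reflection \<alpha>" and ?c = "\<lambda>z. (-1) ^ len z * normal_coeff (len w) (opposite_T w) z"
  have sign: "(-1) ^ len z = - ((-1) ^ len (?s \<circ> z) :: rat poly fract)"
    using weyl_length_simple_comp[OF step.hyps(1) step.prems] by auto
  have distrib: "e * (- a + (if b then x * c else 0)) = e' * a + (if b then x * (e * c) else 0)"
    if "e = - e'" for e e' a c x :: "rat poly fract" and b
    by (simp add: that algebra_simps)
  have eq: "(-1) ^ len z * normal_coeff (len (?s \<circ> w)) (opposite_T (?s \<circ> w)) z =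
      ?c (?s \<circ> z) + (if len (?s \<circ> z) = Suc (len z) then (indet - inverse indet) * ?c z else 0)"
    unfolding opposite_T_simple_comp[OF step.hyps] step.hyps(3)
      normal_coeff_opposite_simple_mult[OF step.hyps(1) step.prems]
    using distrib[OF sign] .
  show ?case
    unfolding eq
    by (intro nat_poly_in_add nat_poly_in_if nat_poly_in_0 nat_poly_in_mult_variable
        step.IH step.prems simple_comp_weyl_group[OF step.hyps(1) step.prems])
qed

lemma nat_poly_in_R_tilde:
  assumes "w \<in> W" "z \<in> W"
  shows "nat_poly_in (indet - inverse indet) (R_tilde z w)"
proof -
  have "R_tilde z w = (-1) ^ len z * normal_coeff (len w) (opposite_T w) z"
    unfolding R_tilde_def R_def normal_coeff_def opposite_T_def coeff_T_def q_embed_minus_one_power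
    by simp
  then show ?thesis using nat_poly_in_opposite_coeff[OF assms] by simp
qed

end

theorem proposition5p2:
  fixes \<Phi> \<Delta> :: "'a::euclidean_space set"
    and scale :: "rat poly fract \<Rightarrow> 'h::ring_1 \<Rightarrow> 'h"
    and T :: "('a \<Rightarrow> 'a) \<Rightarrow> 'h"
    and w :: "'a \<Rightarrow> 'a"
  assumes "iwahori_hecke_algebra \<Phi> \<Delta> scale T"
    and "w \<in> weyl_group \<Phi>"
  shows "(nat_poly_in (indet - inverse indet)
            (iwahori_hecke_algebra.tau_tilde \<Phi> \<Delta> scale T w) \<and>
          bar (iwahori_hecke_algebra.tau_tilde \<Phi> \<Delta> scale T w) =
            iwahori_hecke_algebra.tau_tilde \<Phi> \<Delta> scale T w) \<and>
         (\<forall>z \<in> weyl_group \<Phi>.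
          nat_poly_in (indet - inverse indet)
            (iwahori_hecke_algebra.R_tilde \<Phi> \<Delta> scale T z w) \<and>
          bar (iwahori_hecke_algebra.R_tilde \<Phi> \<Delta> scale T z w) =
            iwahori_hecke_algebra.R_tilde \<Phi> \<Delta> scale T z w)"
proof -
  interpret iwahori_hecke_algebra \<Phi> \<Delta> scale T by fact
  show ?thesis
    using nat_poly_in_tau_tilde nat_poly_in_R_tilde assms(2)
      bar_nat_poly_in[OF _ bar_indet_minus_inverse] by blast
qed

end
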